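(* Fix $\hbar>0$, $m\in\mathbb{N}=\{1,2,3,\dots\}$ and frequencies $\varpi_1,\dots,\varpi_m\in(0,\infty)$. The Tate Rabinowitz quantized energy values for $m$ (uncoupled) harmonic oscillators of frequencies $\varpi_i$, $1\le i\le m$, are given by $$E_n=\sum_{i=1}^m\big(n_i-\tfrac12\big)\varpi_i\hbar,\qquad n=(n_1,\dots,n_m)\in\mathbb{N}^m.$$
   Context: Let $E>0$ and $\kappa=(\kappa_1,\dots,\kappa_m)\in(0,\infty)^m$; let $e_1,\dots,e_m$ be the standard basis of $\mathbb{R}^m$, $\langle\cdot,\cdot\rangle$ the standard inner product, $\varpi=(\tfrac1{\varpi_1},\dots,\tfrac1{\varpi_m})$, and $\zeta_k=\sum_i k_i$ for $k\in\mathbb{Z}^m$. The Floer complex of the $m$-fold iterated Tate Rabinowitz action functional for the Hamiltonian $\sum_i\pi\varpi_i|z_i|^2-E$ on $\mathbb{C}^m$ is described as follows. Let $(\Omega_\nu)_{\nu\in\mathbb{Z}+\frac{m-1}{2}}$ be the sequence of integer multiples of $\tfrac1{\varpi_1},\dots,\tfrac1{\varpi_m}$ arranged in nondecreasing order with repetitions, indexed so that $\Omega_{-\frac{m-1}{2}}=\Omega_{\frac{m-1}{2}}=0$; thus $\Omega_{-\nu}=-\Omega_\nu$. Choose maps $\varepsilon:\mathbb{Z}+\tfrac{m-1}{2}\to\{e_1,\dots,e_m\}$ and $\mu:\mathbb{Z}+\tfrac{m-1}{2}\to\mathbb{Z}$ such that, for all $\nu\in\mathbb{Z}+\tfrac{m-1}{2}$,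 $\Omega_\nu=\mu(\nu)\langle\varpi,\varepsilon(\nu)\rangle$, $\varepsilon(-\nu)=\varepsilon(\nu)$ and $\mu(-\nu)=-\mu(\nu)$. (If all ratios $\varpi_i/\varpi_j$, $i\ne j$, are irrational, $\varepsilon$ and $\mu$ are uniquely determined for $|\nu|>\tfrac{m-1}{2}$; in the presence of rational ratios $\varepsilon$ is not uniquely determined.) Generators: $u^\pm_{\nu,k}$, $\nu\in\mathbb{Z}+\tfrac{m-1}{2}$, $k\in\mathbb{Z}^m$, with degrees $|u^-_{\nu,k}|=2(\nu+\zeta_k)$, $|u^+_{\nu,k}|=2(\nu+\zeta_k)+1$ and action $\mathfrak{A}^E_\kappa(u^\pm_{\nu,k})=\langle\kappa,k\rangle+E\Omega_\nu$. For $\nu\in\mathbb{Z}+\tfrac{m-1}{2}$, $C_{2\nu+1}$ (resp. $C_{2\nu}$) is the abelian group of all formal sums $\sum_{k\in\mathbb{Z}^m}\xi_ku^+_{\nu-\zeta_k,k}$ (resp. $\sum_{k\in\mathbb{Z}^m}\xi_ku^-_{\nu-\zeta_k,k}$) with arbitrary $\xi_k\in\mathbb{Z}$. The boundary operator is the extension to infinite sums of $\partial u^-_{\nu,k}=u^+_{\nu-1,k}+\mu(\nu)\,u^+_{\nu,k-\varepsilon(\nu)}$, $\partial u^+_{\nu,k}=0$. Let $H_*$ be its homology (the Tate Rabinowitz Floer homology). The commuting isomorphisms $\mathfrak{U}_i(u^\pm_{\nu,k})=u^\pm_{\nu,k+e_i}$, $1\le i\le m$, commute with $\partial$ and induce commuting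 isomorphisms $\mathfrak{u}_i:H_n\to H_{n+2}$, hence an action of $\mathbb{Z}^m$ on homology (a $\mathbb{Z}[\mathbb{Z}^m]$-module structure). Shifted action: $\widetilde{\mathfrak{A}}^E_\kappa(u^+_{\nu,k})=\mathfrak{A}^E_\kappa(u^+_{\nu,k})+\tfrac{\nu\hbar}{2}$. For $0\ne\xi=\sum_k\xi_ku^+_{\nu-\zeta_k,k}\in C_{2\nu+1}$ put $\sigma(\xi)=\sup\{\widetilde{\mathfrak{A}}^E_\kappa(u^+_{\nu-\zeta_k,k})\mid\xi_k\ne0\}$, and for $0\ne\alpha\in H_{2\nu+1}$ define the spectral number $\sigma(\alpha)=\inf\{\sigma(\xi)\mid[\xi]=\alpha\}\in[-\infty,\infty]$. A real number $E>0$ is called a Tate Rabinowitz quantized energy value for the $m$ harmonic oscillators if there exist $\kappa\in(0,\infty)^m$, $\nu\in\mathbb{Z}+\tfrac{m-1}{2}$ and $0\ne\alpha\in H_{2\nu+1}$ whose equivalence class under the $\mathbb{Z}^m$-action has a well-defined spectral number in $\mathbb{R}/\hbar\mathbb{Z}$, i.e. for all $(j_1,\dots,j_m)\in\mathbb{Z}^m$ the number $\sigma(\mathfrak{u}_1^{j_1}\cdots\mathfrak{u}_m^{j_m}\alpha)$ is finite and congruent to $\sigma(\alpha)$ modulo $\hbar\mathbb{Z}$.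
   Formalization: With rational frequency ratios, ε and μ are also required to label each nonzero multiple of each 1/ϖ_i by exactly one ν; otherwise, e.g. for ϖ=(1,1) and ε constant, only odd multiples of ħ would be energy values. *)

theory Defs
  imports "HOL-Analysis.Analysis" "HOL-Algebra.Coset"
begin

text \<open>
  The number of oscillators is \<open>m = CARD('m)\<close>; multi-indices are vectors of type \<open>int ^ 'm\<close>, and
  \<open>w $ i\<close> is the frequency of the \<open>i\<close>-th oscillator. The basis vector \<open>\<epsilon>(\<nu>)\<close> is represented by its
  position in \<open>'m\<close>. Functions of \<open>\<nu>\<close> live on all reals, but only their values on \<open>indices m\<close> matter.
\<close>

definition indices :: "nat \<Rightarrow> real set" where
  "indices m = {\<nu>. \<nu> - (real m - 1) / 2 \<in> \<int>}"

text \<open>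
  The multiples \<open>l / w $ i\<close> in nondecreasing order; the bijection \<open>p\<close> expresses that every value is
  listed as often as it arises from a pair \<open>(i, l)\<close>. These conditions determine \<open>\<Omega>\<close> on \<open>indices m\<close>.
\<close>

definition multiples_sequence :: "real ^ 'm::finite \<Rightarrow> (real \<Rightarrow> real) \<Rightarrow> bool" where
  "multiples_sequence w \<Omega> \<longleftrightarrow>
     mono_on (indices CARD('m)) \<Omega> \<and>
     (\<exists>p :: real \<Rightarrow> 'm \<times> int. bij_betw p (indices CARD('m)) UNIV \<and>
        (\<forall>\<nu>\<in>indices CARD('m). \<Omega> \<nu> = of_int (snd (p \<nu>)) * (1 / w $ fst (p \<nu>)))) \<and>
     \<Omega> (- ((real CARD('m) - 1) / 2)) = 0 \<and> \<Omega> ((real CARD('m) - 1) / 2) = 0"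

text \<open>
  The last condition says that \<open>\<epsilon>\<close> and \<open>\<mu>\<close> label the terms of the sequence \<^emph>\<open>with repetitions\<close>: each
  nonzero multiple of each \<open>1 / w $ i\<close> labels exactly one term. It follows from the other conditions
  when the ratios of the frequencies are irrational, but must be required in the presence of rational
  ratios: for \<open>w = (1, 1)\<close> a constant \<open>\<epsilon>\<close> would otherwise be admitted, which forgets one of the two
  oscillators. At the \<open>m\<close> zero terms \<open>\<mu>\<close> vanishes and \<open>\<epsilon>\<close> is an arbitrary even function.
\<close>

definition multiples_labelling ::
    "real ^ 'm::finite \<Rightarrow> (real \<Rightarrow> real) \<Rightarrow> (real \<Rightarrow> 'm) \<Rightarrow> (real \<Rightarrow> int) \<Rightarrow> bool" where
  "multiples_labelling w \<Omega> \<epsilon> \<mu> \<longleftrightarrow>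
     (\<forall>\<nu>\<in>indices CARD('m).
        \<Omega> \<nu> = of_int (\<mu> \<nu>) * (1 / w $ \<epsilon> \<nu>) \<and> \<epsilon> (- \<nu>) = \<epsilon> \<nu> \<and> \<mu> (- \<nu>) = - \<mu> \<nu>) \<and>
     (\<forall>i l. l \<noteq> 0 \<longrightarrow> (\<exists>!\<nu>. \<nu> \<in> indices CARD('m) \<and> \<epsilon> \<nu> = i \<and> \<mu> \<nu> = l))"

definition zeta :: "int ^ 'm::finite \<Rightarrow> int" where
  "zeta k = (\<Sum>i\<in>UNIV. k $ i)"

text \<open>\<open>UMinus \<nu> k\<close> and \<open>UPlus \<nu> k\<close> are the generators \<open>u\<^sup>-\<close> and \<open>u\<^sup>+\<close>.\<close>

datatype ('m::finite) gen = UMinus (gindex: real) (gmult: "int ^ 'm") | UPlus (gindex: real) (gmult: "int ^ 'm")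

fun degree :: "'m::finite gen \<Rightarrow> real" where
  "degree (UMinus \<nu> k) = 2 * (\<nu> + of_int (zeta k))"
| "degree (UPlus \<nu> k) = 2 * (\<nu> + of_int (zeta k)) + 1"

text \<open>A possibly infinite formal sum of generators is the function giving its coefficients.\<close>

type_synonym 'm chain = "'m gen \<Rightarrow> int"

definition single :: "'m::finite gen \<Rightarrow> 'm chain" where
  "single x = (\<lambda>y. if y = x then 1 else 0)"

definition chain_group :: "real \<Rightarrow> 'm::finite chain monoid" where
  "chain_group n =
     \<lparr>carrier = {c. \<forall>x. c x \<noteq> 0 \<longrightarrow> gindex x \<in> indices CARD('m) \<and> degree x = n},
      mult = (\<lambda>a b x. a x + b x), one = (\<lambda>x. 0)\<rparr>"

fun boundary_gen :: "(real \<Rightarrow> 'm::finite) \<Rightarrow> (real \<Rightarrow> int) \<Rightarrow> 'm gen \<Rightarrow> 'm chain" where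
  "boundary_gen \<epsilon> \<mu> (UMinus \<nu> k) =
     (\<lambda>y. single (UPlus (\<nu> - 1) k) y + \<mu> \<nu> * single (UPlus \<nu> (k - axis (\<epsilon> \<nu>) 1)) y)"
| "boundary_gen \<epsilon> \<mu> (UPlus \<nu> k) = (\<lambda>y. 0)"

text \<open>
  Extension to infinite sums: a fixed generator \<open>y\<close> occurs in the boundary of only finitely many
  generators \<open>x\<close>, so the sum is finite.
\<close>

definition boundary :: "(real \<Rightarrow> 'm::finite) \<Rightarrow> (real \<Rightarrow> int) \<Rightarrow> 'm chain \<Rightarrow> 'm chain" where
  "boundary \<epsilon> \<mu> c = (\<lambda>y. \<Sum>x | boundary_gen \<epsilon> \<mu> x y \<noteq> 0. c x * boundary_gen \<epsilon> \<mu> x y)"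

lemma finite_boundary_gen: "finite {x. boundary_gen \<epsilon> \<mu> x y \<noteq> 0}"
proof (rule finite_subset)
  show "{x. boundary_gen \<epsilon> \<mu> x y \<noteq> 0} \<subseteq>
    {UMinus (gindex y + 1) (gmult y), UMinus (gindex y) (gmult y + axis (\<epsilon> (gindex y)) 1)}"
  proof
    fix x assume "x \<in> {x. boundary_gen \<epsilon> \<mu> x y \<noteq> 0}"
    then show "x \<in> {UMinus (gindex y + 1) (gmult y), UMinus (gindex y) (gmult y + axis (\<epsilon> (gindex y)) 1)}"
      by (cases x) (auto simp: single_def split: if_splits)
  qed
qed simp

definition cycles :: "(real \<Rightarrow> 'm::finite) \<Rightarrow> (real \<Rightarrow> int) \<Rightarrow> real \<Rightarrow> 'm chain set" where
  "cycles \<epsilon> \<mu> n = kernel (chain_group n) (chain_group (n - 1)) (boundary \<epsilon> \<mu>)"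

definition boundaries :: "(real \<Rightarrow> 'm::finite) \<Rightarrow> (real \<Rightarrow> int) \<Rightarrow> real \<Rightarrow> 'm chain set" where
  "boundaries \<epsilon> \<mu> n = boundary \<epsilon> \<mu> ` carrier (chain_group (n + 1))"

text \<open>Homology classes are cosets, so a chain \<open>\<xi>\<close> represents the class \<open>\<alpha>\<close> iff \<open>\<xi> \<in> \<alpha>\<close>.\<close>

definition homology :: "(real \<Rightarrow> 'm::finite) \<Rightarrow> (real \<Rightarrow> int) \<Rightarrow> real \<Rightarrow> 'm chain set monoid" where
  "homology \<epsilon> \<mu> n = ((chain_group n)\<lparr>carrier := cycles \<epsilon> \<mu> n\<rparr>) Mod boundaries \<epsilon> \<mu> n"

text \<open>
  \<open>shift j\<close> is the composite of the powers of the commuting isomorphisms shifting \<open>k\<close> by the basis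
  vectors, the \<open>i\<close>-th of them taken to the power \<open>j $ i\<close>; see the three lemmas below.
\<close>

fun shift_gen :: "int ^ 'm::finite \<Rightarrow> 'm gen \<Rightarrow> 'm gen" where
  "shift_gen j (UMinus \<nu> k) = UMinus \<nu> (k + j)"
| "shift_gen j (UPlus \<nu> k) = UPlus \<nu> (k + j)"

definition shift :: "int ^ 'm::finite \<Rightarrow> 'm chain \<Rightarrow> 'm chain" where
  "shift j c = (\<lambda>x. c (shift_gen (- j) x))"

lemma shift_single: "shift j (single x) = single (shift_gen j x)"
proof
  fix y show "shift j (single x) y = single (shift_gen j x) y"
    by (cases x; cases y) (auto simp: shift_def single_def algebra_simps)
qed

lemma shift_add: "shift (i + j) c = shift i (shift j c)"
proof
  fix x show "shift (i + j) c x = shift i (shift j c) x"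
    by (cases x) (auto simp: shift_def algebra_simps)
qed

lemma shift_zero: "shift 0 c = c"
proof
  fix x show "shift 0 c x = c x"
    by (cases x) (auto simp: shift_def)
qed

text \<open>
  The action induced on homology. As \<open>shift j\<close> is an isomorphism of the complex shifting degrees by
  \<open>2 * zeta j\<close>, the image of a class is again a class.
\<close>

definition hshift :: "int ^ 'm::finite \<Rightarrow> 'm chain set \<Rightarrow> 'm chain set" where
  "hshift j \<alpha> = shift j ` \<alpha>"

definition action_value ::
    "(real \<Rightarrow> real) \<Rightarrow> real \<Rightarrow> real ^ 'm::finite \<Rightarrow> 'm gen \<Rightarrow> real" where
  "action_value \<Omega> E \<kappa> x = \<kappa> \<bullet> (\<chi> i. of_int (gmult x $ i)) + E * \<Omega> (gindex x)"

text \<open>The shifted action; only its values on generators \<open>UPlus \<nu> k\<close> are used.\<close>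

definition shifted_action ::
    "real \<Rightarrow> (real \<Rightarrow> real) \<Rightarrow> real \<Rightarrow> real ^ 'm::finite \<Rightarrow> 'm gen \<Rightarrow> real" where
  "shifted_action h \<Omega> E \<kappa> x = action_value \<Omega> E \<kappa> x + gindex x * h / 2"

definition chain_spectral ::
    "real \<Rightarrow> (real \<Rightarrow> real) \<Rightarrow> real \<Rightarrow> real ^ 'm::finite \<Rightarrow> 'm chain \<Rightarrow> ereal" where
  "chain_spectral h \<Omega> E \<kappa> \<xi> = (SUP x\<in>{x. \<xi> x \<noteq> 0}. ereal (shifted_action h \<Omega> E \<kappa> x))"

definition spectral_number ::
    "real \<Rightarrow> (real \<Rightarrow> real) \<Rightarrow> real \<Rightarrow> real ^ 'm::finite \<Rightarrow> 'm chain set \<Rightarrow> ereal" where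
  "spectral_number h \<Omega> E \<kappa> \<alpha> = (INF \<xi>\<in>\<alpha>. chain_spectral h \<Omega> E \<kappa> \<xi>)"

definition tate_quantized_energy ::
    "real \<Rightarrow> (real \<Rightarrow> real) \<Rightarrow> (real \<Rightarrow> 'm::finite) \<Rightarrow> (real \<Rightarrow> int) \<Rightarrow> real \<Rightarrow> bool" where
  "tate_quantized_energy h \<Omega> \<epsilon> \<mu> E \<longleftrightarrow>
     E > 0 \<and>
     (\<exists>\<kappa> :: real ^ 'm. (\<forall>i. \<kappa> $ i > 0) \<and>
       (\<exists>\<nu>\<in>indices CARD('m). \<exists>\<alpha>\<in>carrier (homology \<epsilon> \<mu> (2 * \<nu> + 1)).
          \<alpha> \<noteq> \<one>\<^bsub>homology \<epsilon> \<mu> (2 * \<nu> + 1)\<^esub> \<and>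
          (\<forall>j :: int ^ 'm.
             \<bar>spectral_number h \<Omega> E \<kappa> (hshift j \<alpha>)\<bar> \<noteq> \<infinity> \<and>
             (\<exists>p :: int. spectral_number h \<Omega> E \<kappa> (hshift j \<alpha>) =
                         spectral_number h \<Omega> E \<kappa> \<alpha> + ereal (of_int p * h)))))"

end

theory Submission
  imports Defs
begin

text \<open>
  In odd degrees the complex is a product over lines \<open>UPlus (\<nu> - n) (k + \<dots>)\<close>, on each of which the
  boundary operator takes a sequence \<open>d\<close> to \<open>d n + \<mu> (\<nu> - n) * d (n + 1)\<close>. Hence a chain whose
  coefficients vanish far down every line is a boundary, whereas the constant chain \<open>1\<close> on a line
  with all \<open>\<bar>\<mu>\<bar> \<ge> 3\<close> is not: a primitive \<open>d\<close> would decrease in absolute value forever.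

  The terms of the sequence \<open>\<Omega>\<close> that lie in \<open>[-T, 0)\<close> and are labelled by \<open>i\<close> number
  \<open>T * w $ i + O(1)\<close>, so that the shifted action at the point of a line where \<open>\<Omega> = -T\<close> is
  \<open>D * T + O(1)\<close> with \<open>D = (\<Sum>i. (\<kappa> $ i - h / 2) * w $ i) - E\<close>. If \<open>D > 0\<close>, all spectral numbers of
  nonzero classes are \<open>\<infinity>\<close>; if \<open>D < 0\<close>, truncating chains shows that they are \<open>-\<infinity>\<close>; if \<open>D = 0\<close>, the
  class of the chain above has a finite one. Finally, the \<open>i\<close>-th shift adds \<open>\<kappa> $ i\<close> to the spectral
  number, which forces \<open>\<kappa> $ i\<close> to be a positive multiple of \<open>h\<close>.
\<close>

section \<open>The boundary operator and the subgroup of boundaries\<close>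

lemma indices_diff_int: "a \<in> indices m \<Longrightarrow> b \<in> indices m \<Longrightarrow> a - b \<in> \<int>"
  unfolding indices_def by (auto dest: Ints_diff)

lemma indices_add_int [simp]: "z \<in> \<int> \<Longrightarrow> a + z \<in> indices m \<longleftrightarrow> a \<in> indices m"
  unfolding indices_def
  by (smt (verit, best) Ints_add Ints_diff mem_Collect_eq)

lemma indices_diff_nat [simp]: "a - real n \<in> indices m \<longleftrightarrow> a \<in> indices m"
  using indices_add_int[of "- real n" a m] by simp

lemma zeta_add: "zeta (a + b) = zeta a + zeta b"
  by (simp add: zeta_def sum.distrib)

lemma zeta_axis [simp]: "zeta (axis i 1) = 1"
  by (simp add: zeta_def axis_def)

lemma boundary_UMinus [simp]: "boundary \<epsilon> \<mu> c (UMinus \<nu> k) = 0"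
  unfolding boundary_def
proof (rule sum.neutral, rule ballI)
  fix x :: "'a gen"
  show "c x * boundary_gen \<epsilon> \<mu> x (UMinus \<nu> k) = 0"
    by (cases x) (auto simp: single_def)
qed

lemma boundary_UPlus:
  "boundary \<epsilon> \<mu> c (UPlus \<nu> k) =
     c (UMinus (\<nu> + 1) k) + \<mu> \<nu> * c (UMinus \<nu> (k + axis (\<epsilon> \<nu>) 1))"
proof -
  let ?y = "UPlus \<nu> k"
  let ?S = "{UMinus (\<nu> + 1) k, UMinus \<nu> (k + axis (\<epsilon> \<nu>) 1)}"
  have "{x. boundary_gen \<epsilon> \<mu> x ?y \<noteq> 0} \<subseteq> ?S"
  proof
    fix x assume "x \<in> {x. boundary_gen \<epsilon> \<mu> x ?y \<noteq> 0}"
    then show "x \<in> ?S"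
      by (cases x) (auto simp: single_def split: if_splits)
  qed
  then have "boundary \<epsilon> \<mu> c ?y = (\<Sum>x\<in>?S. c x * boundary_gen \<epsilon> \<mu> x ?y)"
    unfolding boundary_def by (intro sum.mono_neutral_left) auto
  also have "\<dots> = c (UMinus (\<nu> + 1) k) + \<mu> \<nu> * c (UMinus \<nu> (k + axis (\<epsilon> \<nu>) 1))"
    \<comment> \<open>The indices \<open>\<nu> + 1\<close> and \<open>\<nu>\<close> differ, so the
      sum has two separate terms, and in each of them only one summand of
      \<open>boundary_gen\<close> hits \<open>?y\<close>.\<close>
    by (simp add: single_def)
  finally show ?thesis .
qed

lemma boundary_add:
  "boundary \<epsilon> \<mu> (\<lambda>x. a x + b x) = (\<lambda>x. boundary \<epsilon> \<mu> a x + boundary \<epsilon> \<mu> b x)"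
proof
  fix x show "boundary \<epsilon> \<mu> (\<lambda>x. a x + b x) x = boundary \<epsilon> \<mu> a x + boundary \<epsilon> \<mu> b x"
    by (cases x) (auto simp: boundary_UPlus algebra_simps)
qed

lemma boundary_minus: "boundary \<epsilon> \<mu> (\<lambda>x. - a x) = (\<lambda>x. - boundary \<epsilon> \<mu> a x)"
proof
  fix x show "boundary \<epsilon> \<mu> (\<lambda>x. - a x) x = - boundary \<epsilon> \<mu> a x"
    by (cases x) (auto simp: boundary_UPlus)
qed

lemma boundaries_add:
  assumes "a \<in> boundaries \<epsilon> \<mu> n" "b \<in> boundaries \<epsilon> \<mu> n"
  shows "(\<lambda>x. a x + b x) \<in> boundaries \<epsilon> \<mu> n"
proof -
  obtain c d where "c \<in> carrier (chain_group (n + 1))" "d \<in> carrier (chain_group (n + 1))"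
    "a = boundary \<epsilon> \<mu> c" "b = boundary \<epsilon> \<mu> d"
    using assms unfolding boundaries_def by auto
  then show ?thesis
    unfolding boundaries_def
    by (intro image_eqI[of _ _ "\<lambda>x. c x + d x"])
       (auto simp: boundary_add chain_group_def, (metis add.left_neutral)+)
qed

lemma boundaries_minus:
  assumes "a \<in> boundaries \<epsilon> \<mu> n"
  shows "(\<lambda>x. - a x) \<in> boundaries \<epsilon> \<mu> n"
proof -
  obtain c where "c \<in> carrier (chain_group (n + 1))" "a = boundary \<epsilon> \<mu> c"
    using assms unfolding boundaries_def by auto
  then show ?thesis
    unfolding boundaries_def
    by (intro image_eqI[of _ _ "\<lambda>x. - c x"]) (auto simp: boundary_minus chain_group_def)
qed

lemma zero_in_boundaries: "(\<lambda>x. 0) \<in> boundaries \<epsilon> \<mu> n"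
  unfolding boundaries_def
proof (rule image_eqI)
  show "(\<lambda>x. 0) \<in> carrier (chain_group (n + 1))"
    by (simp add: chain_group_def)
qed (simp add: boundary_def)

text \<open>Both \<open>UMinus\<close> neighbours of \<open>UPlus a k\<close> have degree one
  higher: one because of its index \<open>a + 1\<close>, the other because of the extra basis
  vector.\<close>

lemma boundaries_subset:
  fixes \<epsilon> :: "real \<Rightarrow> 'm::finite"
  shows "boundaries \<epsilon> \<mu> n \<subseteq> carrier (chain_group n)"
proof -
  have "gindex x \<in> indices CARD('m) \<and> degree x = n"
    if c: "c \<in> carrier (chain_group (n + 1))" and x: "boundary \<epsilon> \<mu> c x \<noteq> 0" for c x
  proof (cases x)
    case (UPlus a k)
    then have "c (UMinus (a + 1) k) \<noteq> 0 \<or> c (UMinus a (k + axis (\<epsilon> a) 1)) \<noteq> 0"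
      using x by (auto simp: boundary_UPlus)
    then show ?thesis
    proof
      assume "c (UMinus (a + 1) k) \<noteq> 0"
      with c have "a + 1 \<in> indices CARD('m)" "degree (UMinus (a + 1) k) = n + 1"
        unfolding chain_group_def by force+
      then show ?thesis using UPlus by simp
    next
      assume "c (UMinus a (k + axis (\<epsilon> a) 1)) \<noteq> 0"
      with c have "a \<in> indices CARD('m)" "degree (UMinus a (k + axis (\<epsilon> a) 1)) = n + 1"
        unfolding chain_group_def by force+
      then show ?thesis using UPlus by (simp add: zeta_add)
    qed
  qed (use x in simp)
  then have "boundary \<epsilon> \<mu> c \<in> carrier (chain_group n)" if "c \<in> carrier (chain_group (n + 1))" for c
    unfolding chain_group_def[of n] using that by simp
  then show ?thesis
    unfolding boundaries_def by blast
qed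

section \<open>Chains and homology in the degrees of the \<open>UPlus\<close> generators\<close>

lemma odd_chain_UMinus:
  fixes \<xi> :: "'m::finite chain"
  assumes "\<xi> \<in> carrier (chain_group (2 * \<nu> + 1))" "\<nu> \<in> indices CARD('m)"
  shows "\<xi> (UMinus a k) = 0"
proof (rule ccontr)
  assume "\<xi> (UMinus a k) \<noteq> 0"
  then have a: "a \<in> indices CARD('m)" and d: "2 * (a + of_int (zeta k)) = 2 * \<nu> + 1"
    using assms(1) unfolding chain_group_def by force+
  obtain z where "\<nu> - a = of_int z"
    using indices_diff_int[OF assms(2) a] by (auto elim: Ints_cases)
  \<comment> \<open>Indices differ by integers, so the degree of a \<open>UMinus\<close> is
    \<open>2 * \<nu>\<close> plus an even integer. Oddness is relative to \<open>2 * \<nu>\<close>,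
    which need not be even itself.\<close>
  then have "of_int (2 * zeta k) = (of_int (2 * z + 1) :: real)"
    using d by (simp add: algebra_simps)
  then have "2 * zeta k = 2 * z + 1"
    by (simp only: of_int_eq_iff)
  then show False
    by presburger
qed

text \<open>Only \<open>UPlus\<close> generators occur in this degree, and their boundary is zero.
  Homology is thus the quotient of all chains by the boundaries.\<close>

lemma cycles_odd:
  assumes "\<nu> \<in> indices CARD('m::finite)"
  shows "cycles (\<epsilon> :: real \<Rightarrow> 'm) \<mu> (2 * \<nu> + 1) = carrier (chain_group (2 * \<nu> + 1))"
proof -
  have "boundary \<epsilon> \<mu> \<xi> = (\<lambda>x. 0)" if "\<xi> \<in> carrier (chain_group (2 * \<nu> + 1))" for \<xi>
  proof
    fix x show "boundary \<epsilon> \<mu> \<xi> x = 0"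
      using odd_chain_UMinus[OF that assms] by (cases x) (auto simp: boundary_UPlus)
  qed
  moreover have "\<one>\<^bsub>chain_group (2 * \<nu> + 1 - 1) :: 'm chain monoid\<^esub> = (\<lambda>x. 0)"
    by (simp add: chain_group_def)
  ultimately show ?thesis
    unfolding cycles_def kernel_def by auto
qed

lemma carrier_homology_odd:
  assumes "\<nu> \<in> indices CARD('m::finite)"
  shows "carrier (homology (\<epsilon> :: real \<Rightarrow> 'm) \<mu> (2 * \<nu> + 1)) =
    {(\<lambda>b x. b x + \<xi> x) ` boundaries \<epsilon> \<mu> (2 * \<nu> + 1) | \<xi>. \<xi> \<in> carrier (chain_group (2 * \<nu> + 1))}"
proof -
  have "mult (chain_group n) a b = (\<lambda>x. a x + b x)" for n and a b :: "'m chain"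
    by (simp add: chain_group_def)
  then show ?thesis
    unfolding homology_def FactGroup_def cycles_odd[OF assms] RCOSETS_def r_coset_def by auto
qed

lemma one_homology: "\<one>\<^bsub>homology \<epsilon> \<mu> n\<^esub> = boundaries \<epsilon> \<mu> n"
  by (simp add: homology_def)

lemma coset_eq_boundaries:
  assumes "\<xi> \<in> boundaries \<epsilon> \<mu> n"
  shows "(\<lambda>b x. b x + \<xi> x) ` boundaries \<epsilon> \<mu> n = boundaries \<epsilon> \<mu> n"
proof (intro equalityI subsetI)
  fix b assume "b \<in> boundaries \<epsilon> \<mu> n"
  then show "b \<in> (\<lambda>b x. b x + \<xi> x) ` boundaries \<epsilon> \<mu> n"
    using boundaries_add[OF _ boundaries_minus[OF assms]]
    by (intro image_eqI[of _ _ "\<lambda>x. b x + - \<xi> x"]) auto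
qed (use boundaries_add[OF _ assms] in auto)

subsection \<open>The lines of the complex\<close>

definition line_offset :: "(real \<Rightarrow> 'm::finite) \<Rightarrow> real \<Rightarrow> nat \<Rightarrow> int ^ 'm" where
  "line_offset \<epsilon> \<nu> n = (\<Sum>j<n. axis (\<epsilon> (\<nu> - real j)) 1)"

text \<open>
  Consecutive points of a line are the two generators occurring in the boundary of one generator
  \<open>UMinus\<close>.
\<close>

definition line :: "(real \<Rightarrow> 'm::finite) \<Rightarrow> real \<Rightarrow> int ^ 'm \<Rightarrow> nat \<Rightarrow> 'm gen" where
  "line \<epsilon> \<nu> k n = UPlus (\<nu> - real n) (k + line_offset \<epsilon> \<nu> n)"

lemma line_0 [simp]: "line \<epsilon> \<nu> k 0 = UPlus \<nu> k"
  by (simp add: line_def line_offset_def)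

lemma line_offset_add:
  "line_offset \<epsilon> \<nu> (a + n) = line_offset \<epsilon> \<nu> a + line_offset \<epsilon> (\<nu> - real a) n"
  by (induction n) (simp_all add: line_offset_def algebra_simps)

lemma line_add: "line \<epsilon> \<nu> k (a + n) = line \<epsilon> (\<nu> - real a) (k + line_offset \<epsilon> \<nu> a) n"
  by (simp add: line_def line_offset_add algebra_simps)

lemma line_Suc: "line \<epsilon> \<nu> k (Suc n) = line \<epsilon> (\<nu> - 1) (k + axis (\<epsilon> \<nu>) 1) n"
  using line_add[of \<epsilon> \<nu> k 1 n] by (simp add: line_offset_def)

text \<open>This compensates the drop of the index by \<open>n\<close>, so all points of a line have
  the same degree.\<close>

lemma zeta_line_offset: "zeta (line_offset \<epsilon> \<nu> n) = int n"
proof (induction n)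
  case 0 then show ?case by (simp add: line_offset_def zeta_def)
next
  case (Suc n) then show ?case by (simp add: line_offset_def zeta_add)
qed

text \<open>Writing \<open>d n\<close> for the first coefficient, this is
  \<open>d n + \<mu> (\<nu> - real n) * d (Suc n)\<close>; the index of the second one is left
  unsimplified to show this.\<close>

lemma boundary_line:
  "boundary \<epsilon> \<mu> c (line \<epsilon> \<nu> k n) =
     c (UMinus (\<nu> - real n + 1) (k + line_offset \<epsilon> \<nu> n)) +
     \<mu> (\<nu> - real n) * c (UMinus (\<nu> - real (Suc n) + 1) (k + line_offset \<epsilon> \<nu> (Suc n)))"
  by (simp add: line_def boundary_UPlus line_offset_def algebra_simps)

text \<open>
  The coefficient at \<open>UMinus (\<nu> + 1) k\<close> of a primitive of \<open>\<xi>\<close> whose coefficient vanishes \<open>N\<close> steps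
  further down the line.
\<close>

primrec line_primitive ::
    "(real \<Rightarrow> 'm::finite) \<Rightarrow> (real \<Rightarrow> int) \<Rightarrow> 'm chain \<Rightarrow> nat \<Rightarrow> real \<Rightarrow> int ^ 'm \<Rightarrow> int" where
  "line_primitive \<epsilon> \<mu> \<xi> 0 \<nu> k = 0"
| "line_primitive \<epsilon> \<mu> \<xi> (Suc N) \<nu> k =
     \<xi> (UPlus \<nu> k) - \<mu> \<nu> * line_primitive \<epsilon> \<mu> \<xi> N (\<nu> - 1) (k + axis (\<epsilon> \<nu>) 1)"

text \<open>Started from 0 further down, the recursion keeps the value 0 as long as
  \<open>\<xi>\<close> vanishes. Different cutoffs for neighbouring points can therefore be made to
  agree.\<close>

lemma line_primitive_stable:
  assumes "\<forall>n\<ge>N. \<xi> (line \<epsilon> \<nu> k n) = 0" "N \<le> M"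
  shows "line_primitive \<epsilon> \<mu> \<xi> M \<nu> k = line_primitive \<epsilon> \<mu> \<xi> N \<nu> k"
  using assms
proof (induction M arbitrary: N \<nu> k)
  case (Suc M)
  show ?case
  proof (cases N)
    case 0
    have "\<forall>n\<ge>0. \<xi> (line \<epsilon> (\<nu> - 1) (k + axis (\<epsilon> \<nu>) 1) n) = 0"
      using Suc.prems(1) 0 line_Suc[of \<epsilon> \<nu> k] by (metis zero_le)
    from Suc.IH[OF this] Suc.prems(1) 0 show ?thesis
      using line_0[of \<epsilon> \<nu> k] by (metis diff_zero line_primitive.simps mult_zero_right zero_le)
  next
    case (Suc N')
    have "\<forall>n\<ge>N'. \<xi> (line \<epsilon> (\<nu> - 1) (k + axis (\<epsilon> \<nu>) 1) n) = 0"
      using Suc.prems(1) Suc line_Suc[of \<epsilon> \<nu> k] by (metis Suc_le_mono)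
    from Suc.IH[OF this] Suc.prems(2) Suc show ?thesis
      by simp
  qed
qed simp

text \<open>On each line the recursion for a primitive is solved upwards, starting with 0 below the
  last nonzero coefficient of \<open>\<xi>\<close>. The unknown to be found has coefficient 1, so no
  division by \<open>\<mu>\<close> occurs.\<close>

lemma boundary_if_tails_vanish:
  fixes \<xi> :: "'m::finite chain"
  assumes \<xi>: "\<xi> \<in> carrier (chain_group (2 * \<nu> + 1))" and \<nu>: "\<nu> \<in> indices CARD('m)"
    and tails: "\<And>a k. a \<in> indices CARD('m) \<Longrightarrow> \<exists>N. \<forall>n\<ge>N. \<xi> (line \<epsilon> a k n) = 0"
  shows "\<xi> \<in> boundaries \<epsilon> \<mu> (2 * \<nu> + 1)"
proof -
  \<comment> \<open>\<open>P\<close> singles out the generators \<open>UPlus a k\<close> of degree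
    \<open>2 * \<nu> + 1\<close>.\<close>
  define P where "P a k \<longleftrightarrow> a \<in> indices CARD('m) \<and> a + of_int (zeta k) = \<nu>" for a and k :: "int ^ 'm"
  define L where "L a k = (SOME N. \<forall>n\<ge>N. \<xi> (line \<epsilon> a k n) = 0)" for a k
  define r where "r a k = line_primitive \<epsilon> \<mu> \<xi> (L a k) a k" for a k
  \<comment> \<open>The index is shifted by one because \<open>UPlus (a - 1) k\<close> is the term
    of coefficient 1 in the boundary of \<open>UMinus a k\<close>.\<close>
  define c where "c x = (case x of UMinus a k \<Rightarrow> if P (a - 1) k then r (a - 1) k else 0 | UPlus a k \<Rightarrow> 0)"
    for x
  have L: "\<forall>n\<ge>L a k. \<xi> (line \<epsilon> a k n) = 0" if "a \<in> indices CARD('m)" for a k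
    using someI_ex[OF tails[OF that]] unfolding L_def .
  have rec: "r a k = \<xi> (UPlus a k) - \<mu> a * r (a - 1) (k + axis (\<epsilon> a) 1)"
    if a: "a \<in> indices CARD('m)" for a k
  proof -
    have a1: "a - 1 \<in> indices CARD('m)"
      using a indices_diff_nat[of a 1] by simp
    \<comment> \<open>A cutoff valid for both points: \<open>Suc M\<close> steps from the first are
      \<open>M\<close> steps from the next one.\<close>
    define M where "M = max (L a k) (L (a - 1) (k + axis (\<epsilon> a) 1))"
    have "r a k = line_primitive \<epsilon> \<mu> \<xi> (Suc M) a k"
      unfolding r_def using line_primitive_stable[OF L[OF a], of k "Suc M"] by (simp add: M_def)
    also have "\<dots> = \<xi> (UPlus a k) - \<mu> a * r (a - 1) (k + axis (\<epsilon> a) 1)"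
      unfolding r_def
      using line_primitive_stable[OF L[OF a1], of "k + axis (\<epsilon> a) 1" M] by (simp add: M_def)
    finally show ?thesis .
  qed
  have "c \<in> carrier (chain_group (2 * \<nu> + 1 + 1))"
  proof -
    have "gindex x \<in> indices CARD('m) \<and> degree x = 2 * \<nu> + 1 + 1" if x: "c x \<noteq> 0" for x
    proof -
      obtain a k where "x = UMinus a k" and "P (a - 1) k"
        using x by (cases x) (auto simp: c_def split: if_splits)
      then show ?thesis
        using indices_diff_nat[of a 1] by (auto simp: P_def)
    qed
    then show ?thesis
      by (simp add: chain_group_def)
  qed
  moreover have "boundary \<epsilon> \<mu> c = \<xi>"
  proof
    fix x show "boundary \<epsilon> \<mu> c x = \<xi> x"
    proof (cases x)
      case (UMinus a k)
      then show ?thesis using odd_chain_UMinus[OF \<xi> \<nu>] by simp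
    next
      case (UPlus a k)
      have P': "P (a - 1) (k + axis (\<epsilon> a) 1) \<longleftrightarrow> P a k"
        using indices_diff_nat[of a 1] by (auto simp: P_def zeta_add)
      have "\<xi> (UPlus a k) = 0" if "\<not> P a k"
        using \<xi> that unfolding chain_group_def P_def by force
      then show ?thesis
        using UPlus rec[of a k] P' by (auto simp: boundary_UPlus c_def P_def)
    qed
  qed
  ultimately show ?thesis
    unfolding boundaries_def by blast
qed

subsection \<open>The action along a line\<close>

lemma line_offset_nth: "line_offset \<epsilon> \<nu> n $ i = int (card {j. j < n \<and> \<epsilon> (\<nu> - real j) = i})"
proof -
  have "line_offset \<epsilon> \<nu> n $ i = (\<Sum>j<n. if \<epsilon> (\<nu> - real j) = i then 1 else 0)"
    by (auto simp: line_offset_def axis_def intro!: sum.cong)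
  also have "\<dots> = int (card ({..<n} \<inter> {j. \<epsilon> (\<nu> - real j) = i}))"
    by (simp add: sum.If_cases)
  also have "{..<n} \<inter> {j. \<epsilon> (\<nu> - real j) = i} = {j. j < n \<and> \<epsilon> (\<nu> - real j) = i}"
    by auto
  finally show ?thesis .
qed

locale labelled_multiples =
  fixes w :: "real ^ 'm::finite" and \<Omega> :: "real \<Rightarrow> real" and \<epsilon> :: "real \<Rightarrow> 'm" and \<mu> :: "real \<Rightarrow> int"
  assumes w_pos: "w $ i > 0"
    and mono_Omega: "mono_on (indices CARD('m)) \<Omega>"
    and labelling: "multiples_labelling w \<Omega> \<epsilon> \<mu>"
begin

lemma Omega_eq: "\<nu> \<in> indices CARD('m) \<Longrightarrow> \<Omega> \<nu> = of_int (\<mu> \<nu>) / w $ \<epsilon> \<nu>"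
  using labelling by (simp add: multiples_labelling_def)

lemma Omega_less_imp_less:
  "a \<in> indices CARD('m) \<Longrightarrow> b \<in> indices CARD('m) \<Longrightarrow> \<Omega> a < \<Omega> b \<Longrightarrow> a < b"
  using mono_Omega by (meson mono_onD not_le_imp_less not_less)

text \<open>Coordinate \<open>i\<close> counts the indices labelled \<open>i\<close> in a segment.
  Their values of \<open>\<mu>\<close> are distinct nonzero integers that exhaust an interval up to
  its end points, and such a count differs from the length of the interval by at most 1.\<close>

lemma line_offset_approx:
  assumes s: "s \<in> indices CARD('m)" and neg: "\<Omega> s < 0"
  shows "\<bar>of_int (line_offset \<epsilon> s n $ i) - (\<Omega> s - \<Omega> (s - real n)) * w $ i\<bar> \<le> 1"
proof -
  let ?J = "{j. j < n \<and> \<epsilon> (s - real j) = i}"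
  let ?f = "\<lambda>j. - \<mu> (s - real j)"
  \<comment> \<open>Negated and multiplied by \<open>w $ i\<close>, the values of
    \<open>\<Omega>\<close> at indices labelled \<open>i\<close> become the integers
    \<open>?f j\<close>, which lie between \<open>x\<close> and \<open>y\<close>.\<close>
  define x where "x = - \<Omega> s * w $ i"
  define y where "y = - \<Omega> (s - real n) * w $ i"
  have J: "finite ?J" by simp
  have wi: "w $ i > 0" by (rule w_pos)
  have le: "\<Omega> (s - real b) \<le> \<Omega> (s - real a)" if "a \<le> b" for a b
    using mono_Omega s that by (intro mono_onD[of _ \<Omega>]) auto
  have val: "real_of_int (?f j) = - \<Omega> (s - real j) * w $ i" if "j \<in> ?J" for j
    using Omega_eq[of "s - real j"] s that wi by simp
  \<comment> \<open>Here \<open>\<Omega> s < 0\<close> enters: \<open>\<Omega>\<close> stays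
    negative further down, so \<open>\<mu>\<close> is nonzero and the uniqueness of labels
    applies.\<close>
  have nz: "?f j \<noteq> 0" if "j \<in> ?J" for j
    using Omega_eq[of "s - real j"] le[of 0 j] neg s by auto
  have unique: "\<exists>!\<nu>. \<nu> \<in> indices CARD('m) \<and> \<epsilon> \<nu> = i \<and> \<mu> \<nu> = l" if "l \<noteq> 0" for l
    using labelling that by (simp add: multiples_labelling_def)
  have inj: "inj_on ?f ?J"
  proof (rule inj_onI)
    fix a b assume ab: "a \<in> ?J" "b \<in> ?J" "?f a = ?f b"
    then have "s - real a = s - real b"
      using unique[of "\<mu> (s - real a)"] nz[OF ab(1)] s
      by (metis (mono_tags, lifting) add.inverse_inverse add.inverse_neutral indices_diff_nat mem_Collect_eq)
    then show "a = b" by simp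
  qed
  have "?f ` ?J \<subseteq> {\<lceil>x\<rceil>..\<lfloor>y\<rfloor>}"
  proof
    fix l assume "l \<in> ?f ` ?J"
    then obtain j where j: "j \<in> ?J" "l = ?f j" by blast
    have "\<Omega> (s - real n) * w $ i \<le> \<Omega> (s - real j) * w $ i" "\<Omega> (s - real j) * w $ i \<le> \<Omega> s * w $ i"
      using le[of j n] le[of 0 j] j wi by auto
    then show "l \<in> {\<lceil>x\<rceil>..\<lfloor>y\<rfloor>}"
      using val[OF j(1)] j(2) unfolding x_def y_def by (auto simp: ceiling_le_iff le_floor_iff)
  qed
  then have "card ?J \<le> card {\<lceil>x\<rceil>..\<lfloor>y\<rfloor>}"
    using card_image[OF inj] card_mono[of "{\<lceil>x\<rceil>..\<lfloor>y\<rfloor>}" "?f ` ?J"] by simp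
  then have up: "int (card ?J) \<le> max 0 (\<lfloor>y\<rfloor> - \<lceil>x\<rceil> + 1)"
    by simp
  \<comment> \<open>These are the integers strictly between \<open>x\<close> and \<open>y\<close>.
    Strictness puts the index with label \<open>- l\<close> inside the segment; at an end value,
    ties of \<open>\<Omega>\<close> could place it outside.\<close>
  have "{\<lfloor>x\<rfloor> + 1..\<lceil>y\<rceil> - 1} \<subseteq> ?f ` ?J"
  proof
    fix l assume "l \<in> {\<lfloor>x\<rfloor> + 1..\<lceil>y\<rceil> - 1}"
    then have l: "x < of_int l" "of_int l < y"
      by (auto simp: floor_less_iff less_ceiling_iff) linarith+
    have "x > 0"
      using neg wi by (simp add: x_def mult_neg_pos)
    with l(1) have "- l \<noteq> 0" by linarith
    then obtain a where a: "a \<in> indices CARD('m)" "\<epsilon> a = i" "\<mu> a = - l"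
      using unique by blast
    have Oa: "\<Omega> a * w $ i = - of_int l"
      using Omega_eq[OF a(1)] a wi by simp
    have "\<Omega> a * w $ i < \<Omega> s * w $ i" "\<Omega> (s - real n) * w $ i < \<Omega> a * w $ i"
      using l Oa unfolding x_def y_def by linarith+
    then have "a < s" "s - real n < a"
      using Omega_less_imp_less a(1) s wi by auto
    moreover obtain z where "s - a = of_int z"
      using indices_diff_int[OF s a(1)] by (auto elim: Ints_cases)
    ultimately have "a = s - real (nat z)" "nat z < n"
      by linarith+
    then show "l \<in> ?f ` ?J"
      using a by (intro image_eqI[of _ _ "nat z"]) auto
  qed
  then have "card {\<lfloor>x\<rfloor> + 1..\<lceil>y\<rceil> - 1} \<le> card ?J"
    using card_image[OF inj] card_mono[of "?f ` ?J" "{\<lfloor>x\<rfloor> + 1..\<lceil>y\<rceil> - 1}"] J by simp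
  then have lo: "\<lceil>y\<rceil> - 1 - \<lfloor>x\<rfloor> \<le> int (card ?J)"
    by simp
  \<comment> \<open>This settles the case in which the maximum in \<open>up\<close> is 0.\<close>
  have "x \<le> y"
    using le[of 0 n] wi unfolding x_def y_def by simp
  then have "\<bar>real_of_int (int (card ?J)) - (y - x)\<bar> \<le> 1"
    using up lo by linarith
  moreover have "y - x = (\<Omega> s - \<Omega> (s - real n)) * w $ i"
    by (simp add: x_def y_def algebra_simps)
  ultimately show ?thesis
    by (simp only: line_offset_nth)
qed

lemma ex_Omega_neg: "\<exists>s\<in>indices CARD('m). \<Omega> s < 0"
proof -
  obtain s where "s \<in> indices CARD('m)" "\<mu> s = -1"
    using labelling unfolding multiples_labelling_def by (metis neg_equal_0_iff_equal zero_neq_one)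
  then show ?thesis
    using Omega_eq[of s] w_pos[of "\<epsilon> s"] by (intro bexI[of _ s]) auto
qed

lemma Omega_eventually_neg:
  assumes "\<nu> \<in> indices CARD('m)"
  shows "\<exists>a. \<Omega> (\<nu> - real a) < 0"
proof -
  obtain s where s: "s \<in> indices CARD('m)" "\<Omega> s < 0"
    using ex_Omega_neg by blast
  obtain a where "\<nu> - s \<le> real a"
    using real_arch_simple by blast
  then have "\<Omega> (\<nu> - real a) \<le> \<Omega> s"
    using mono_Omega s assms by (intro mono_onD[of _ \<Omega>]) auto
  then show ?thesis
    using s by (intro exI[of _ a]) linarith
qed

text \<open>Summed over \<open>i\<close>, the offsets give \<open>n\<close>, while their
  approximations give a fixed multiple of the descent of \<open>\<Omega>\<close> up to a bounded
  error. So \<open>\<Omega>\<close> must descend without bound.\<close>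

lemma Omega_at_bot:
  assumes \<nu>: "\<nu> \<in> indices CARD('m)"
  shows "filterlim (\<lambda>n. \<Omega> (\<nu> - real n)) at_bot sequentially"
proof -
  obtain a where neg: "\<Omega> (\<nu> - real a) < 0"
    using Omega_eventually_neg[OF \<nu>] by blast
  define s where "s = \<nu> - real a"
  define W where "W = (\<Sum>i\<in>UNIV. w $ i)"
  have W: "W > 0"
    unfolding W_def by (intro sum_pos) (auto simp: w_pos)
  have s: "s \<in> indices CARD('m)" "\<Omega> s < 0"
    using \<nu> neg by (auto simp: s_def)
  have le: "real n \<le> (\<Omega> s - \<Omega> (s - real n)) * W + CARD('m)" for n
  proof -
    have "real n = of_int (zeta (line_offset \<epsilon> s n))"
      by (simp add: zeta_line_offset)
    also have "\<dots> = (\<Sum>i\<in>UNIV. of_int (line_offset \<epsilon> s n $ i))"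
      by (simp add: zeta_def)
    also have "\<dots> \<le> (\<Sum>i\<in>UNIV. (\<Omega> s - \<Omega> (s - real n)) * w $ i + 1)"
      by (intro sum_mono) (use line_offset_approx[OF s] in \<open>smt (verit)\<close>)
    finally show ?thesis
      by (simp add: W_def sum_distrib_left sum.distrib)
  qed
  have "filterlim (\<lambda>n. \<Omega> (s - real n)) at_bot sequentially"
    unfolding filterlim_at_bot
  proof
    fix Z :: real
    have "\<forall>\<^sub>F n in sequentially. (\<Omega> s - Z) * W + CARD('m) \<le> real n"
      by (rule eventually_sequentiallyI[of "nat \<lceil>(\<Omega> s - Z) * W + CARD('m)\<rceil>"]) linarith
    then show "\<forall>\<^sub>F n in sequentially. \<Omega> (s - real n) \<le> Z"
    proof eventually_elim
      case (elim n)
      then have "(\<Omega> s - Z) * W \<le> (\<Omega> s - \<Omega> (s - real n)) * W"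
        using le[of n] by linarith
      then show ?case
        using W by simp
    qed
  qed
  \<comment> \<open>The finitely many indices before \<open>s\<close> do not affect the
    limit.\<close>
  then have "filterlim (\<lambda>n. \<Omega> (\<nu> - real (n + a))) at_bot sequentially"
    by (simp add: s_def algebra_simps)
  then show ?thesis
    unfolding filterlim_at_bot by (subst (asm) eventually_sequentially_seg)
qed

text \<open>There are only finitely many frequencies, so \<open>\<Omega>\<close> eventually lies
  below all the \<open>- 3 / w $ i\<close>. The bound 3 is what the descent in
  \<open>boundary_ne_minus_one_on_line\<close> uses.\<close>

lemma mu_eventually_ge:
  assumes "\<nu> \<in> indices CARD('m)"
  shows "\<exists>a. \<forall>n\<ge>a. \<bar>\<mu> (\<nu> - real n)\<bar> \<ge> 3"
proof -
  have "\<forall>\<^sub>F n in sequentially. \<forall>i. \<Omega> (\<nu> - real n) \<le> - 3 / w $ i"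
    using Omega_at_bot[OF assms] unfolding filterlim_at_bot by (intro eventually_all_finite) blast
  then obtain a where a: "\<Omega> (\<nu> - real n) \<le> - 3 / w $ i" if "n \<ge> a" for n i
    unfolding eventually_sequentially by blast
  have "\<bar>\<mu> (\<nu> - real n)\<bar> \<ge> 3" if "n \<ge> a" for n
  proof -
    let ?i = "\<epsilon> (\<nu> - real n)"
    have "of_int (\<mu> (\<nu> - real n)) / w $ ?i \<le> - 3 / w $ ?i"
      using a[OF that, of ?i] Omega_eq[of "\<nu> - real n"] assms by simp
    then have "real_of_int (\<mu> (\<nu> - real n)) / w $ ?i * w $ ?i \<le> - 3 / w $ ?i * w $ ?i"
      using w_pos[of ?i] by (intro mult_right_mono) auto
    then have "real_of_int (\<mu> (\<nu> - real n)) \<le> - 3"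
      using w_pos[of ?i] by simp
    then show ?thesis by linarith
  qed
  then show ?thesis by blast
qed

text \<open>Up to a bounded error the offsets are
  \<open>- w $ i * \<Omega> (\<nu> - real n)\<close>. Since \<open>n\<close> is the sum of the
  offsets, the contribution \<open>- n * h / 2\<close> of the index can be distributed over the
  coordinates, which turns \<open>\<kappa> $ i\<close> into
  \<open>\<kappa> $ i - h / 2\<close>.\<close>

lemma action_along_line:
  assumes \<nu>: "\<nu> \<in> indices CARD('m)"
  shows "\<exists>B. \<forall>n. \<bar>shifted_action h \<Omega> E \<kappa> (line \<epsilon> \<nu> k n) +
    ((\<Sum>i\<in>UNIV. (\<kappa> $ i - h / 2) * w $ i) - E) * \<Omega> (\<nu> - real n)\<bar> \<le> B"
proof -
  let ?D = "(\<Sum>i\<in>UNIV. (\<kappa> $ i - h / 2) * w $ i) - E"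
  let ?A = "\<lambda>\<nu> k n. shifted_action h \<Omega> E \<kappa> (line \<epsilon> \<nu> k n) + ?D * \<Omega> (\<nu> - real n)"
  \<comment> \<open>\<open>line_offset_approx\<close> applies only from a negative value of
    \<open>\<Omega>\<close> on; \<open>Bseq_offset\<close> takes care of the first \<open>a\<close>
    points in the end.\<close>
  obtain a where neg: "\<Omega> (\<nu> - real a) < 0"
    using Omega_eventually_neg[OF \<nu>] by blast
  define s where "s = \<nu> - real a"
  define k' where "k' = k + line_offset \<epsilon> \<nu> a"
  have s: "s \<in> indices CARD('m)" "\<Omega> s < 0"
    using \<nu> neg by (auto simp: s_def)
  define C where "C = (\<Sum>i\<in>UNIV. \<kappa> $ i * of_int (k' $ i)) + s * h / 2"
  \<comment> \<open>The 1 is the error in \<open>line_offset_approx\<close>, and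
    \<open>\<bar>\<Omega> s\<bar> * w $ i\<close> bounds the constant term there.\<close>
  define B where "B = \<bar>C\<bar> + (\<Sum>i\<in>UNIV. \<bar>\<kappa> $ i - h / 2\<bar> * (1 + \<bar>\<Omega> s\<bar> * w $ i))"
  have bound: "\<bar>?A s k' n\<bar> \<le> B" for n
  proof -
    let ?N = "\<lambda>i. real_of_int (line_offset \<epsilon> s n $ i)"
    have n: "real n = (\<Sum>i\<in>UNIV. ?N i)"
      using arg_cong[OF zeta_line_offset[of \<epsilon> s n], of real_of_int] by (simp add: zeta_def)
    have "?A s k' n = (\<Sum>i\<in>UNIV. \<kappa> $ i * (of_int (k' $ i) + ?N i)) + E * \<Omega> (s - real n)
        + (s - real n) * h / 2 + ?D * \<Omega> (s - real n)"
      by (simp add: shifted_action_def action_value_def line_def inner_vec_def)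
    also have "\<dots> = C + (\<Sum>i\<in>UNIV. \<kappa> $ i * ?N i) - (\<Sum>i\<in>UNIV. ?N i) * (h / 2)
        + (\<Sum>i\<in>UNIV. (\<kappa> $ i - h / 2) * w $ i) * \<Omega> (s - real n)"
      unfolding C_def n by (simp add: algebra_simps sum.distrib diff_divide_distrib)
    also have "\<dots> = C + (\<Sum>i\<in>UNIV. (\<kappa> $ i - h / 2) * (?N i + w $ i * \<Omega> (s - real n)))"
      unfolding sum_distrib_right by (simp add: algebra_simps sum.distrib sum_subtractf)
    finally have eq: "?A s k' n = C + (\<Sum>i\<in>UNIV. (\<kappa> $ i - h / 2) * (?N i + w $ i * \<Omega> (s - real n)))" .
    have "\<bar>?N i + w $ i * \<Omega> (s - real n)\<bar> \<le> 1 + \<bar>\<Omega> s\<bar> * w $ i" for i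
    proof -
      have "\<bar>\<Omega> s * w $ i\<bar> = \<bar>\<Omega> s\<bar> * w $ i"
        using w_pos[of i] by (simp add: abs_mult)
      with line_offset_approx[OF s, of n i] show ?thesis
        by (simp add: algebra_simps)
    qed
    then have "\<bar>\<Sum>i\<in>UNIV. (\<kappa> $ i - h / 2) * (?N i + w $ i * \<Omega> (s - real n))\<bar>
        \<le> (\<Sum>i\<in>UNIV. \<bar>\<kappa> $ i - h / 2\<bar> * (1 + \<bar>\<Omega> s\<bar> * w $ i))"
      by (intro order_trans[OF sum_abs] sum_mono) (simp add: abs_mult mult_left_mono)
    then show ?thesis
      unfolding eq B_def by linarith
  qed
  have shift: "?A \<nu> k (n + a) = ?A s k' n" for n
    using line_add[of \<epsilon> \<nu> k a n] by (simp add: s_def k'_def algebra_simps)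
  have "Bseq (\<lambda>n. ?A \<nu> k (n + a))"
    unfolding shift by (rule BseqI'[of _ B]) (use bound in simp)
  then have "Bseq (?A \<nu> k)"
    by (rule Bseq_offset)
  then show ?thesis
    by (auto simp: Bseq_def)
qed

end

subsection \<open>Spectral numbers\<close>

lemma shifted_action_shift_gen:
  "shifted_action h \<Omega> E \<kappa> (shift_gen j x) = shifted_action h \<Omega> E \<kappa> x + \<kappa> \<bullet> (\<chi> i. of_int (j $ i))"
  by (cases x)
     (auto simp: shifted_action_def action_value_def inner_vec_def algebra_simps sum.distrib)

lemma SUP_ereal_add_real: "(SUP x\<in>A. f x + ereal r) = (SUP x\<in>A. f x) + ereal r"
  \<comment> \<open>The supremum of the empty set is \<open>- \<infinity>\<close>, which absorbs the
    real summand.\<close>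
  by (cases "A = {}") (auto simp: SUP_ereal_add_left bot_ereal_def)

lemma INF_ereal_add_real:
  fixes f :: "'a \<Rightarrow> ereal"
  shows "(INF x\<in>A. f x + ereal r) = (INF x\<in>A. f x) + ereal r"
proof (rule antisym)
  have "(INF x\<in>A. f x + ereal r) - ereal r \<le> (INF x\<in>A. f x)"
    by (intro INF_greatest) (auto simp: ereal_minus_le intro: INF_lower2)
  then show "(INF x\<in>A. f x + ereal r) \<le> (INF x\<in>A. f x) + ereal r"
    by (simp add: ereal_minus_le)
qed (auto intro!: INF_greatest add_right_mono INF_lower)

text \<open>The shift carries the support over and raises every action in it by the same
  amount.\<close>

lemma chain_spectral_shift:
  "chain_spectral h \<Omega> E \<kappa> (shift j \<xi>) =
     chain_spectral h \<Omega> E \<kappa> \<xi> + ereal (\<kappa> \<bullet> (\<chi> i. of_int (j $ i)))"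
proof -
  have inv: "shift_gen (- j) (shift_gen j x) = x" "shift_gen j (shift_gen (- j) x) = x" for x
    by (cases x; simp)+
  have "{x. shift j \<xi> x \<noteq> 0} = shift_gen j ` {x. \<xi> x \<noteq> 0}"
  proof (intro equalityI subsetI)
    fix x assume "x \<in> {x. shift j \<xi> x \<noteq> 0}"
    then show "x \<in> shift_gen j ` {x. \<xi> x \<noteq> 0}"
      by (intro image_eqI[of _ _ "shift_gen (- j) x"]) (auto simp: shift_def inv)
  qed (auto simp: shift_def inv)
  then have "chain_spectral h \<Omega> E \<kappa> (shift j \<xi>) = (SUP x\<in>{x. \<xi> x \<noteq> 0}.
      ereal (shifted_action h \<Omega> E \<kappa> x) + ereal (\<kappa> \<bullet> (\<chi> i. of_int (j $ i))))"
    by (simp add: chain_spectral_def image_image shifted_action_shift_gen)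
  then show ?thesis
    by (simp only: SUP_ereal_add_real chain_spectral_def)
qed

text \<open>For a class with finite spectral number, the congruence modulo \<open>h\<close> thus
  becomes a condition on \<open>\<kappa>\<close> alone.\<close>

lemma spectral_number_hshift:
  "spectral_number h \<Omega> E \<kappa> (hshift j \<alpha>) =
     spectral_number h \<Omega> E \<kappa> \<alpha> + ereal (\<kappa> \<bullet> (\<chi> i. of_int (j $ i)))"
  by (simp add: spectral_number_def hshift_def image_image chain_spectral_shift INF_ereal_add_real)

section \<open>Spectral numbers of nonzero classes, by the sign of the constant
  \<open>D\<close>\<close>

context labelled_multiples
begin

text \<open>Up to a bounded error the action is a constant times \<open>\<Omega>\<close>, which
  tends to minus infinity. Here and in \<open>action_at_top\<close> the local \<open>D\<close> is
  chosen positive.\<close>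

lemma action_at_bot:
  assumes "\<nu> \<in> indices CARD('m)" "(\<Sum>i\<in>UNIV. (\<kappa> $ i - h / 2) * w $ i) < E"
  shows "filterlim (\<lambda>n. shifted_action h \<Omega> E \<kappa> (line \<epsilon> \<nu> k n)) at_bot sequentially"
  unfolding filterlim_at_bot
proof
  fix Z
  define D where "D = E - (\<Sum>i\<in>UNIV. (\<kappa> $ i - h / 2) * w $ i)"
  have D: "D > 0" using assms(2) by (simp add: D_def)
  obtain B where B: "\<bar>shifted_action h \<Omega> E \<kappa> (line \<epsilon> \<nu> k n) - D * \<Omega> (\<nu> - real n)\<bar> \<le> B" for n
    using action_along_line[OF assms(1), of h E \<kappa> k] by (auto simp: D_def algebra_simps)
  have "\<forall>\<^sub>F n in sequentially. \<Omega> (\<nu> - real n) \<le> (Z - B) / D"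
    using Omega_at_bot[OF assms(1)] unfolding filterlim_at_bot by blast
  then show "\<forall>\<^sub>F n in sequentially. shifted_action h \<Omega> E \<kappa> (line \<epsilon> \<nu> k n) \<le> Z"
  proof eventually_elim
    case (elim n)
    then have "D * \<Omega> (\<nu> - real n) \<le> Z - B"
      using D by (simp add: field_simps)
    with B[of n] show ?case by linarith
  qed
qed

lemma action_at_top:
  assumes "\<nu> \<in> indices CARD('m)" "(\<Sum>i\<in>UNIV. (\<kappa> $ i - h / 2) * w $ i) > E"
  shows "filterlim (\<lambda>n. shifted_action h \<Omega> E \<kappa> (line \<epsilon> \<nu> k n)) at_top sequentially"
  unfolding filterlim_at_top
proof
  fix Z
  define D where "D = (\<Sum>i\<in>UNIV. (\<kappa> $ i - h / 2) * w $ i) - E"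
  have D: "D > 0" using assms(2) by (simp add: D_def)
  obtain B where B: "\<bar>shifted_action h \<Omega> E \<kappa> (line \<epsilon> \<nu> k n) + D * \<Omega> (\<nu> - real n)\<bar> \<le> B" for n
    using action_along_line[OF assms(1), of h E \<kappa> k] by (auto simp: D_def)
  have "\<forall>\<^sub>F n in sequentially. \<Omega> (\<nu> - real n) \<le> - (Z + B) / D"
    using Omega_at_bot[OF assms(1)] unfolding filterlim_at_bot by blast
  then show "\<forall>\<^sub>F n in sequentially. Z \<le> shifted_action h \<Omega> E \<kappa> (line \<epsilon> \<nu> k n)"
  proof eventually_elim
    case (elim n)
    then have "D * \<Omega> (\<nu> - real n) \<le> - (Z + B)"
      using D by (simp add: field_simps)
    with B[of n] show ?case by linarith
  qed
qed

lemma chain_in_nonzero_class: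
  assumes "\<nu> \<in> indices CARD('m)" "\<alpha> \<in> carrier (homology \<epsilon> \<mu> (2 * \<nu> + 1))"
    and "\<alpha> \<noteq> \<one>\<^bsub>homology \<epsilon> \<mu> (2 * \<nu> + 1)\<^esub>" "\<xi> \<in> \<alpha>"
  shows "\<xi> \<in> carrier (chain_group (2 * \<nu> + 1))" "\<xi> \<notin> boundaries \<epsilon> \<mu> (2 * \<nu> + 1)"
    "b \<in> boundaries \<epsilon> \<mu> (2 * \<nu> + 1) \<Longrightarrow> (\<lambda>x. \<xi> x - b x) \<in> \<alpha>"
proof -
  obtain \<eta> where \<eta>: "\<eta> \<in> carrier (chain_group (2 * \<nu> + 1))"
    "\<alpha> = (\<lambda>b x. b x + \<eta> x) ` boundaries \<epsilon> \<mu> (2 * \<nu> + 1)"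
    using assms(2) carrier_homology_odd[OF assms(1)] by auto
  then obtain a where a: "a \<in> boundaries \<epsilon> \<mu> (2 * \<nu> + 1)" "\<xi> = (\<lambda>x. a x + \<eta> x)"
    using assms(4) by auto
  have "a \<in> carrier (chain_group (2 * \<nu> + 1))"
    using a(1) boundaries_subset by auto
  with \<eta>(1) a(2) show "\<xi> \<in> carrier (chain_group (2 * \<nu> + 1))"
    by (auto simp: chain_group_def) (metis add.left_neutral)+
  show "\<xi> \<notin> boundaries \<epsilon> \<mu> (2 * \<nu> + 1)"
  proof
    assume "\<xi> \<in> boundaries \<epsilon> \<mu> (2 * \<nu> + 1)"
    then have "\<eta> \<in> boundaries \<epsilon> \<mu> (2 * \<nu> + 1)"
      using boundaries_add[OF _ boundaries_minus[OF a(1)], of \<xi>] a(2) by simp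
    then show False
      using coset_eq_boundaries[of \<eta>] \<eta>(2) assms(3) by (simp add: one_homology)
  qed
  show "(\<lambda>x. \<xi> x - b x) \<in> \<alpha>" if "b \<in> boundaries \<epsilon> \<mu> (2 * \<nu> + 1)"
    using boundaries_add[OF a(1) boundaries_minus[OF that]] a(2) \<eta>(2)
    by (auto intro!: image_eqI[of _ _ "\<lambda>x. a x + - b x"])
qed

text \<open>No representative is a boundary, so by \<open>boundary_if_tails_vanish\<close> each has
  nonzero coefficients arbitrarily far down some line, where the action is unbounded above.\<close>

lemma spectral_number_infinite:
  assumes \<nu>: "\<nu> \<in> indices CARD('m)" and \<alpha>: "\<alpha> \<in> carrier (homology \<epsilon> \<mu> (2 * \<nu> + 1))"
    "\<alpha> \<noteq> \<one>\<^bsub>homology \<epsilon> \<mu> (2 * \<nu> + 1)\<^esub>"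
    and E: "(\<Sum>i\<in>UNIV. (\<kappa> $ i - h / 2) * w $ i) > E"
  shows "spectral_number h \<Omega> E \<kappa> \<alpha> = \<infinity>"
proof -
  have "chain_spectral h \<Omega> E \<kappa> \<xi> = \<infinity>" if "\<xi> \<in> \<alpha>" for \<xi>
  proof -
    obtain a k where a: "a \<in> indices CARD('m)" and nz: "\<forall>N. \<exists>n\<ge>N. \<xi> (line \<epsilon> a k n) \<noteq> 0"
      using boundary_if_tails_vanish[of \<xi> \<nu> \<epsilon> \<mu>] chain_in_nonzero_class(1,2)[OF \<nu> \<alpha>, of \<xi>] \<nu> \<open>\<xi> \<in> \<alpha>\<close>
      by blast
    have "ereal r \<le> chain_spectral h \<Omega> E \<kappa> \<xi>" for r
    proof -
      obtain N where "r \<le> shifted_action h \<Omega> E \<kappa> (line \<epsilon> a k n)" if "n \<ge> N" for n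
        using action_at_top[OF a E, of k] unfolding filterlim_at_top eventually_sequentially by blast
      then show ?thesis
        using nz unfolding chain_spectral_def by (meson SUP_upper2 ereal_less_eq(3) mem_Collect_eq)
    qed
    then show ?thesis
      by (simp add: ereal_top)
  qed
  then show ?thesis
    by (auto simp: spectral_number_def top_ereal_def intro!: INF_eqI)
qed

text \<open>
  Along each line all but finitely many generators have action at most \<open>r\<close>, so the other ones can be
  dropped from a chain without changing its class.
\<close>

lemma spectral_number_minus_infinite:
  assumes \<nu>: "\<nu> \<in> indices CARD('m)" and \<alpha>: "\<alpha> \<in> carrier (homology \<epsilon> \<mu> (2 * \<nu> + 1))"
    "\<alpha> \<noteq> \<one>\<^bsub>homology \<epsilon> \<mu> (2 * \<nu> + 1)\<^esub>"
    and E: "(\<Sum>i\<in>UNIV. (\<kappa> $ i - h / 2) * w $ i) < E"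
  shows "spectral_number h \<Omega> E \<kappa> \<alpha> = - \<infinity>"
proof -
  obtain \<xi> where \<xi>: "\<xi> \<in> \<alpha>"
    using \<alpha>(1) zero_in_boundaries carrier_homology_odd[OF \<nu>] by fastforce
  note \<xi>_carrier = chain_in_nonzero_class(1)[OF \<nu> \<alpha> \<xi>]
  have "spectral_number h \<Omega> E \<kappa> \<alpha> \<le> ereal r" for r
  proof -
    define b where "b x = (if shifted_action h \<Omega> E \<kappa> x \<le> r then 0 else \<xi> x)" for x
    have "b \<in> boundaries \<epsilon> \<mu> (2 * \<nu> + 1)"
    proof (rule boundary_if_tails_vanish[OF _ \<nu>])
      show "b \<in> carrier (chain_group (2 * \<nu> + 1))"
        using \<xi>_carrier by (auto simp: chain_group_def b_def)
      fix a k assume "a \<in> indices CARD('m)"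
      then obtain N where "shifted_action h \<Omega> E \<kappa> (line \<epsilon> a k n) \<le> r" if "n \<ge> N" for n
        using action_at_bot[OF _ E, of a k] unfolding filterlim_at_bot eventually_sequentially by blast
      then show "\<exists>N. \<forall>n\<ge>N. b (line \<epsilon> a k n) = 0"
        by (auto simp: b_def)
    qed
    then have "(\<lambda>x. \<xi> x - b x) \<in> \<alpha>"
      by (rule chain_in_nonzero_class(3)[OF \<nu> \<alpha> \<xi>])
    moreover have "chain_spectral h \<Omega> E \<kappa> (\<lambda>x. \<xi> x - b x) \<le> ereal r"
      unfolding chain_spectral_def by (intro SUP_least) (auto simp: b_def split: if_splits)
    ultimately show ?thesis
      unfolding spectral_number_def by (metis INF_lower2)
  qed
  then show ?thesis
    by (simp add: ereal_bot)
qed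

text \<open>The value -1 is what a boundary would need to cancel the chain that is constantly 1 on
  the line. It would make the absolute values of \<open>d\<close> an infinite strictly decreasing
  sequence of naturals.\<close>

lemma boundary_ne_minus_one_on_line:
  assumes "\<And>n. \<bar>\<mu> (s - real n)\<bar> \<ge> 3"
  shows "\<exists>n. boundary \<epsilon> \<mu> c (line \<epsilon> s k n) \<noteq> - 1"
proof (rule ccontr)
  assume "\<nexists>n. boundary \<epsilon> \<mu> c (line \<epsilon> s k n) \<noteq> - 1"
  then have eq: "boundary \<epsilon> \<mu> c (line \<epsilon> s k n) = - 1" for n
    by blast
  define d where "d n = c (UMinus (s - real n + 1) (k + line_offset \<epsilon> s n))" for n
  have d: "d n + \<mu> (s - real n) * d (Suc n) = - 1" for n
    using eq[of n] unfolding boundary_line d_def .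
  have descent: "\<bar>d (Suc n)\<bar> < \<bar>d n\<bar>" for n
  proof -
    have "\<bar>\<mu> (s - real n)\<bar> * \<bar>d (Suc n)\<bar> = \<bar>1 + d n\<bar>"
      using d[of n] by (simp add: abs_mult[symmetric])
    moreover have "3 * \<bar>d (Suc n)\<bar> \<le> \<bar>\<mu> (s - real n)\<bar> * \<bar>d (Suc n)\<bar>"
      using assms by (intro mult_right_mono) auto
    ultimately have le: "3 * \<bar>d (Suc n)\<bar> \<le> \<bar>1 + d n\<bar>"
      by simp
    \<comment> \<open>If \<open>d n\<close> were 0, then so would be \<open>d (Suc n)\<close>,
      against the equation \<open>d\<close>. Once \<open>\<bar>d n\<bar> \<ge> 1\<close>, the bound
      \<open>(1 + \<bar>d n\<bar>) / 3\<close> is less than \<open>\<bar>d n\<bar>\<close>.\<close>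
    have "d n \<noteq> 0"
    proof
      assume "d n = 0"
      with le have "d (Suc n) = 0" by linarith
      with d[of n] \<open>d n = 0\<close> show False by simp
    qed
    with le show ?thesis by linarith
  qed
  have "\<bar>d n\<bar> + int n \<le> \<bar>d 0\<bar>" for n
  proof (induction n)
    case (Suc n)
    with descent[of n] show ?case by simp
  qed simp
  from this[of "nat \<bar>d 0\<bar> + 1"] show False by simp
qed

text \<open>Every representative of the class is nonzero somewhere on one line with bounded action,
  which bounds the spectral number below; the representative supported on that line bounds it
  above.\<close>

lemma ex_class_finite_spectral_number:
  assumes E: "(\<Sum>i\<in>UNIV. (\<kappa> $ i - h / 2) * w $ i) = E"
  shows "\<exists>\<nu>\<in>indices CARD('m). \<exists>\<alpha>\<in>carrier (homology \<epsilon> \<mu> (2 * \<nu> + 1)).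
    \<alpha> \<noteq> \<one>\<^bsub>homology \<epsilon> \<mu> (2 * \<nu> + 1)\<^esub> \<and> \<bar>spectral_number h \<Omega> E \<kappa> \<alpha>\<bar> \<noteq> \<infinity>"
proof -
  obtain s\<^sub>0 where s0: "s\<^sub>0 \<in> indices CARD('m)"
    using ex_Omega_neg by blast
  obtain a where a: "\<bar>\<mu> (s\<^sub>0 - real n)\<bar> \<ge> 3" if "n \<ge> a" for n
    using mu_eventually_ge[OF s0] by blast
  define s where "s = s\<^sub>0 - real a"
  have s: "s \<in> indices CARD('m)"
    using s0 by (simp add: s_def)
  have mu: "\<bar>\<mu> (s - real n)\<bar> \<ge> 3" for n
    using a[of "a + n"] by (simp add: s_def algebra_simps)
  \<comment> \<open>The coefficient of \<open>\<Omega>\<close> in \<open>action_along_line\<close>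
    is zero by \<open>E\<close>.\<close>
  obtain B where B: "\<bar>shifted_action h \<Omega> E \<kappa> (line \<epsilon> s 0 n)\<bar> \<le> B" for n
    using action_along_line[OF s, of h E \<kappa> 0] E by auto
  define \<xi> :: "'m chain" where "\<xi> x = (if x \<in> range (line \<epsilon> s 0) then 1 else 0)" for x
  define \<alpha> where "\<alpha> = (\<lambda>b x. b x + \<xi> x) ` boundaries \<epsilon> \<mu> (2 * s + 1)"
  have "\<xi> \<in> carrier (chain_group (2 * s + 1))"
    using s by (auto simp: chain_group_def \<xi>_def line_def zeta_line_offset)
  then have \<alpha>: "\<alpha> \<in> carrier (homology \<epsilon> \<mu> (2 * s + 1))"
    unfolding carrier_homology_odd[OF s] \<alpha>_def by blast
  have nz: "\<exists>n. \<eta> (line \<epsilon> s 0 n) \<noteq> 0" if \<eta>: "\<eta> \<in> \<alpha>" for \<eta>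
  proof -
    obtain c where "\<eta> = (\<lambda>x. boundary \<epsilon> \<mu> c x + \<xi> x)"
      using \<eta> unfolding \<alpha>_def boundaries_def by auto
    moreover obtain n where "boundary \<epsilon> \<mu> c (line \<epsilon> s 0 n) \<noteq> - 1"
      using boundary_ne_minus_one_on_line[OF mu] by blast
    ultimately show ?thesis
      by (intro exI[of _ n]) (auto simp: \<xi>_def)
  qed
  \<comment> \<open>The zero chain belongs to the trivial class but vanishes on the line.\<close>
  have ne: "\<alpha> \<noteq> \<one>\<^bsub>homology \<epsilon> \<mu> (2 * s + 1)\<^esub>"
    using nz[of "\<lambda>x. 0"] zero_in_boundaries by (auto simp: one_homology)
  have "ereal (- B) \<le> chain_spectral h \<Omega> E \<kappa> \<eta>" if \<eta>: "\<eta> \<in> \<alpha>" for \<eta>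
  proof -
    obtain n where "\<eta> (line \<epsilon> s 0 n) \<noteq> 0"
      using nz[OF \<eta>] by blast
    moreover have "ereal (- B) \<le> ereal (shifted_action h \<Omega> E \<kappa> (line \<epsilon> s 0 n))"
      using B[of n] by simp
    ultimately show ?thesis
      unfolding chain_spectral_def by (intro SUP_upper2[of "line \<epsilon> s 0 n"]) auto
  qed
  then have lower: "ereal (- B) \<le> spectral_number h \<Omega> E \<kappa> \<alpha>"
    unfolding spectral_number_def by (rule INF_greatest)
  have "\<xi> \<in> \<alpha>"
    unfolding \<alpha>_def using zero_in_boundaries by (intro image_eqI[of _ _ "\<lambda>x. 0"]) auto
  moreover have "chain_spectral h \<Omega> E \<kappa> \<xi> \<le> ereal B"
    unfolding chain_spectral_def
    by (intro SUP_least) (use B in \<open>auto simp: \<xi>_def abs_le_iff split: if_splits\<close>)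
  ultimately have "spectral_number h \<Omega> E \<kappa> \<alpha> \<le> ereal B"
    unfolding spectral_number_def by (metis INF_lower2)
  with lower have fin: "\<bar>spectral_number h \<Omega> E \<kappa> \<alpha>\<bar> \<noteq> \<infinity>"
    by auto
  show ?thesis
    by (intro bexI[OF _ s] bexI[OF _ \<alpha>] conjI ne fin)
qed

section \<open>Quantization of \<open>\<kappa>\<close> and of the energy\<close>

lemma tate_quantized_energy_iff:
  assumes "h > 0"
  shows "tate_quantized_energy h \<Omega> \<epsilon> \<mu> E \<longleftrightarrow>
    (\<exists>n :: nat ^ 'm. (\<forall>i. n $ i \<ge> 1) \<and> E = (\<Sum>i\<in>UNIV. (real (n $ i) - 1 / 2) * w $ i * h))"
proof
  assume "tate_quantized_energy h \<Omega> \<epsilon> \<mu> E"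
  then obtain \<kappa> :: "real ^ 'm" where \<kappa>: "\<forall>i. \<kappa> $ i > 0"
    and ex: "\<exists>\<nu>\<in>indices CARD('m). \<exists>\<alpha>\<in>carrier (homology \<epsilon> \<mu> (2 * \<nu> + 1)).
      \<alpha> \<noteq> \<one>\<^bsub>homology \<epsilon> \<mu> (2 * \<nu> + 1)\<^esub> \<and>
      (\<forall>j :: int ^ 'm.
         \<bar>spectral_number h \<Omega> E \<kappa> (hshift j \<alpha>)\<bar> \<noteq> \<infinity> \<and>
         (\<exists>p :: int. spectral_number h \<Omega> E \<kappa> (hshift j \<alpha>) =
            spectral_number h \<Omega> E \<kappa> \<alpha> + ereal (of_int p * h)))"
    unfolding tate_quantized_energy_def by - (elim conjE exE, rule that)
  from ex obtain \<nu> \<alpha> where \<nu>: "\<nu> \<in> indices CARD('m)"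
    and \<alpha>: "\<alpha> \<in> carrier (homology \<epsilon> \<mu> (2 * \<nu> + 1))" "\<alpha> \<noteq> \<one>\<^bsub>homology \<epsilon> \<mu> (2 * \<nu> + 1)\<^esub>"
    and spec: "\<forall>j :: int ^ 'm.
      \<bar>spectral_number h \<Omega> E \<kappa> (hshift j \<alpha>)\<bar> \<noteq> \<infinity> \<and>
      (\<exists>p :: int. spectral_number h \<Omega> E \<kappa> (hshift j \<alpha>) =
         spectral_number h \<Omega> E \<kappa> \<alpha> + ereal (of_int p * h))"
    by - (elim bexE conjE, rule that)
  note fin = spec[rule_format, THEN conjunct1] and cong = spec[rule_format, THEN conjunct2]
  \<comment> \<open>The shift by 0 leaves the spectral number unchanged.\<close>
  have fin_\<alpha>: "\<bar>spectral_number h \<Omega> E \<kappa> \<alpha>\<bar> \<noteq> \<infinity>"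
    using fin[of 0] by (simp add: spectral_number_hshift inner_vec_def flip: zero_ereal_def)
  have E: "(\<Sum>i\<in>UNIV. (\<kappa> $ i - h / 2) * w $ i) = E"
  proof (cases "(\<Sum>i\<in>UNIV. (\<kappa> $ i - h / 2) * w $ i)" E rule: linorder_cases)
    case less
    then show ?thesis using spectral_number_minus_infinite[OF \<nu> \<alpha> less] fin_\<alpha> by simp
  next
    case greater
    then show ?thesis using spectral_number_infinite[OF \<nu> \<alpha> greater] fin_\<alpha> by simp
  qed
  have "\<exists>p :: nat. p \<ge> 1 \<and> \<kappa> $ i = real p * h" for i
  proof -
    \<comment> \<open>The unit shift in direction \<open>i\<close> adds \<open>\<kappa> $ i\<close>.
      Finiteness of the spectral number then permits cancelling it on both sides.\<close>
    obtain p :: int where "spectral_number h \<Omega> E \<kappa> \<alpha> + ereal (\<kappa> \<bullet> (\<chi> l. of_int (axis i 1 $ l))) =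
        spectral_number h \<Omega> E \<kappa> \<alpha> + ereal (of_int p * h)"
      using cong[of "axis i 1"] unfolding spectral_number_hshift by blast
    moreover have "(\<chi> l. of_int (axis i 1 $ l)) = (axis i 1 :: real ^ 'm)"
      by (simp add: vec_eq_iff axis_def)
    then have "\<kappa> \<bullet> (\<chi> l. of_int (axis i 1 $ l)) = \<kappa> $ i"
      by (simp add: inner_axis)
    ultimately have p: "\<kappa> $ i = of_int p * h"
      using fin_\<alpha> by (cases "spectral_number h \<Omega> E \<kappa> \<alpha>") auto
    \<comment> \<open>Positivity of \<open>\<kappa>\<close> is the reason why the quantum numbers
      start at 1.\<close>
    then have "p > 0"
      using \<kappa>[rule_format, of i] \<open>h > 0\<close> by (simp add: zero_less_mult_iff)
    with p show ?thesis
      by (intro exI[of _ "nat p"]) auto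
  qed
  then obtain n :: "'m \<Rightarrow> nat" where n: "\<And>i. n i \<ge> 1" "\<And>i. \<kappa> $ i = real (n i) * h"
    by metis
  have "E = (\<Sum>i\<in>UNIV. (real ((\<chi> i. n i) $ i) - 1 / 2) * w $ i * h)"
    unfolding E[symmetric] by (intro sum.cong) (simp_all add: n(2) algebra_simps)
  with n(1) show "\<exists>n :: nat ^ 'm. (\<forall>i. n $ i \<ge> 1) \<and>
      E = (\<Sum>i\<in>UNIV. (real (n $ i) - 1 / 2) * w $ i * h)"
    by (intro exI[of _ "\<chi> i. n i"]) simp
next
  assume "\<exists>n :: nat ^ 'm. (\<forall>i. n $ i \<ge> 1) \<and> E = (\<Sum>i\<in>UNIV. (real (n $ i) - 1 / 2) * w $ i * h)"
  then obtain n :: "nat ^ 'm" where n: "\<And>i. n $ i \<ge> 1"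
    and E: "E = (\<Sum>i\<in>UNIV. (real (n $ i) - 1 / 2) * w $ i * h)"
    by blast
  \<comment> \<open>This choice satisfies the critical equation \<open>E'\<close> and makes every
    shift change the spectral number by an integer multiple of \<open>h\<close>.\<close>
  define \<kappa> :: "real ^ 'm" where "\<kappa> = (\<chi> i. real (n $ i) * h)"
  have n': "real (n $ i) \<ge> 1" for i
    using n[of i] by simp
  have \<kappa>: "\<kappa> $ i > 0" for i
    using n'[of i] \<open>h > 0\<close> by (simp add: \<kappa>_def)
  have "0 < (real (n $ i) - 1 / 2) * w $ i * h" for i
    using n'[of i] w_pos[of i] \<open>h > 0\<close> by (intro mult_pos_pos) linarith+
  then have "E > 0"
    unfolding E by (intro sum_pos) auto
  have E': "(\<Sum>i\<in>UNIV. (\<kappa> $ i - h / 2) * w $ i) = E"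
    unfolding E by (intro sum.cong) (simp_all add: \<kappa>_def algebra_simps)
  obtain \<nu> \<alpha> where \<nu>: "\<nu> \<in> indices CARD('m)"
    and \<alpha>: "\<alpha> \<in> carrier (homology \<epsilon> \<mu> (2 * \<nu> + 1))" "\<alpha> \<noteq> \<one>\<^bsub>homology \<epsilon> \<mu> (2 * \<nu> + 1)\<^esub>"
    and fin: "\<bar>spectral_number h \<Omega> E \<kappa> \<alpha>\<bar> \<noteq> \<infinity>"
    using ex_class_finite_spectral_number[OF E'] by - (elim bexE conjE, rule that)
  have key: "\<bar>spectral_number h \<Omega> E \<kappa> (hshift j \<alpha>)\<bar> \<noteq> \<infinity> \<and>
      (\<exists>p :: int. spectral_number h \<Omega> E \<kappa> (hshift j \<alpha>) =
         spectral_number h \<Omega> E \<kappa> \<alpha> + ereal (of_int p * h))" for j :: "int ^ 'm"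
  proof
    have eq: "\<kappa> \<bullet> (\<chi> i. of_int (j $ i)) = of_int (\<Sum>i\<in>UNIV. int (n $ i) * j $ i) * h"
      by (simp add: \<kappa>_def inner_vec_def sum_distrib_left algebra_simps)
    show "\<exists>p :: int. spectral_number h \<Omega> E \<kappa> (hshift j \<alpha>) =
        spectral_number h \<Omega> E \<kappa> \<alpha> + ereal (of_int p * h)"
      unfolding spectral_number_hshift eq by (rule exI, rule refl)
    show "\<bar>spectral_number h \<Omega> E \<kappa> (hshift j \<alpha>)\<bar> \<noteq> \<infinity>"
      using fin unfolding spectral_number_hshift
      by (cases "spectral_number h \<Omega> E \<kappa> \<alpha>") simp_all
  qed
  show "tate_quantized_energy h \<Omega> \<epsilon> \<mu> E"
    unfolding tate_quantized_energy_def
    by (intro conjI exI[of _ \<kappa>] bexI[OF _ \<nu>] bexI[OF _ \<alpha>(1)] allI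
        \<open>E > 0\<close> \<kappa> \<alpha>(2) key[THEN conjunct1] key[THEN conjunct2])
qed

end

theorem theoremB:
  fixes h :: real and w :: "real ^ 'm::finite"
    and \<Omega> :: "real \<Rightarrow> real" and \<epsilon> :: "real \<Rightarrow> 'm" and \<mu> :: "real \<Rightarrow> int"
  assumes "h > 0"
    and "\<forall>i. w $ i > 0"
    and "multiples_sequence w \<Omega>"
    and "multiples_labelling w \<Omega> \<epsilon> \<mu>"
  shows "{E. tate_quantized_energy h \<Omega> \<epsilon> \<mu> E} =
         {(\<Sum>i\<in>UNIV. (real (n $ i) - 1 / 2) * w $ i * h) | n :: nat ^ 'm. \<forall>i. n $ i \<ge> 1}"
proof -
  have "mono_on (indices CARD('m)) \<Omega>"
    using assms(3) unfolding multiples_sequence_def by (rule conjunct1)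
  then interpret labelled_multiples w \<Omega> \<epsilon> \<mu>
    by (intro labelled_multiples.intro assms(2)[rule_format] assms(4))
  show ?thesis
    by (simp only: tate_quantized_energy_iff[OF assms(1)] conj_commute)
qed

end
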